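(* Let $\mathbb{K}$ be $\mathbb{R}$ or $\mathbb{C}$. The stabilizer of the piecewise linear core tensor $C=C_{\rm axis}\in\mathbb{K}^{m\times m\times m}$ under the congruence action $C\mapsto[\![C;X,X,X]\!]$ by matrices $X\in\mathrm{GL}(m,\mathbb{K})$ is trivial, i.e. it equals $\{\eta I : \eta\in\mathbb{K},\ \eta^3=1\}$.
   Context: The tensor $C_{\rm axis}=(c_{ijk})\in\mathbb{K}^{m\times m\times m}$ has entries $$c_{ijk}=\begin{cases}1&\text{if } i<j<k,\\ \frac12&\text{if } i<j=k\text{ or } i=j<k,\\ \frac16&\text{if } i=j=k,\\ 0&\text{otherwise.}\end{cases}$$ For $X=(x_{ij})\in\mathbb{K}^{m\times m}$, $[\![C;X,X,X]\!]_{\alpha\beta\gamma}=\sum_{i,j,k=1}^m c_{ijk}\,x_{\alpha i}x_{\beta j}x_{\gamma k}$. The stabilizer of $C$ is $\{X\in\mathrm{GL}(m,\mathbb{K}) : [\![C;X,X,X]\!]=C\}$. *)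

theory Defs
  imports Complex_Main "Jordan_Normal_Form.Matrix"
begin

text \<open>
  An \<open>m \<times> m \<times> m\<close> tensor is an array \<open>nat \<Rightarrow> nat \<Rightarrow> nat \<Rightarrow> 'a\<close> of which only the entries with
  all three indices below \<open>m\<close> matter. As for the type \<open>'a mat\<close>, indices start at 0, so
  \<open>{0..<m}\<close> plays the role of \<open>{1..m}\<close>; the entries of the core tensor depend only on the
  relative order of the indices.
\<close>

type_synonym 'a tensor3 = "nat \<Rightarrow> nat \<Rightarrow> nat \<Rightarrow> 'a"

definition eq_tensor3 :: "nat \<Rightarrow> 'a tensor3 \<Rightarrow> 'a tensor3 \<Rightarrow> bool" where
  "eq_tensor3 m C D \<longleftrightarrow> (\<forall>\<alpha><m. \<forall>\<beta><m. \<forall>\<gamma><m. C \<alpha> \<beta> \<gamma> = D \<alpha> \<beta> \<gamma>)"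

definition C_axis :: "'a::field tensor3" where
  "C_axis i j k =
     (if i < j \<and> j < k then 1
      else if (i < j \<and> j = k) \<or> (i = j \<and> j < k) then 1 / 2
      else if i = j \<and> j = k then 1 / 6
      else 0)"

definition congruence :: "nat \<Rightarrow> 'a::field tensor3 \<Rightarrow> 'a mat \<Rightarrow> 'a tensor3" where
  "congruence m C X \<alpha> \<beta> \<gamma> =
     (\<Sum>i<m. \<Sum>j<m. \<Sum>k<m. C i j k * X $$ (\<alpha>, i) * X $$ (\<beta>, j) * X $$ (\<gamma>, k))"

definition GL :: "nat \<Rightarrow> 'a::field mat set" where
  "GL m = {X \<in> carrier_mat m m. invertible_mat X}"

definition stabilizer :: "nat \<Rightarrow> 'a::field tensor3 \<Rightarrow> 'a mat set" where
  "stabilizer m C = {X \<in> GL m. eq_tensor3 m (congruence m C X) C}"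

end

theory Submission
  imports Defs
begin

text \<open>
  Let \<open>G\<close> be the upper triangular matrix with entries 1 above the diagonal and \<open>1/2\<close> on it. Then
  \<open>C\<^sub>i\<^sub>j\<^sub>k = G\<^sub>i\<^sub>j G\<^sub>j\<^sub>k - [i = j = k]/12\<close>, and the shuffle relations
  \<open>C\<^sub>i\<^sub>j\<^sub>k + C\<^sub>i\<^sub>k\<^sub>j + C\<^sub>k\<^sub>i\<^sub>j = G\<^sub>i\<^sub>j\<close> and
  \<open>G\<^sub>i\<^sub>j + G\<^sub>j\<^sub>i = 1\<close> show that the product of any three row sums of a stabilizing \<open>X\<close>
  is 1. So all row sums equal one cube root of unity, and after rescaling they are 1, whence
  \<open>X G X\<^sup>T = G\<close>. Each further step contracts \<open>C\<close> with something already known to be invariant.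
  The vector \<open>d = (-1)\<^sup>i\<close> satisfies \<open>G d = const * 1\<close>, so \<open>X\<^sup>T d = d\<close>; contracting the middle
  slot with \<open>d\<close> gives \<open>X D X\<^sup>T = D\<close> for \<open>D = diag d\<close>. Contracting the last two slots with \<open>D\<close>
  gives \<open>X d = d\<close>, so \<open>X\<^sup>T 1 = 1\<close>. Contracting the first slot with 1 then shows that
  \<open>P = diag (i + 1/2) - D G D / 3\<close> commutes with \<open>X\<close>, and \<open>X D X\<^sup>T = D\<close> that \<open>D P D\<close> commutes with
  \<open>X\<^sup>T\<close>. Both are upper triangular with distinct diagonal entries \<open>i + 1/3\<close>, so \<open>X\<close> is upper and
  lower triangular, hence diagonal, and its row sums force \<open>X = I\<close>.
\<close>

section \<open>The two-index companion of the core tensor and its alternating sums\<close>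

definition axis2 :: "nat \<Rightarrow> nat \<Rightarrow> 'a::field" where
  "axis2 i j = (if i < j then 1 else if i = j then 1 / 2 else 0)"

lemma C_axis_eq_axis2:
  "(C_axis i j k :: 'a::field_char_0) = axis2 i j * axis2 j k - (if i = j \<and> j = k then 1 / 12 else 0)"
  by (auto simp: C_axis_def axis2_def)

text \<open>\<open>C_axis i j k\<close> is the volume of the points s < t < u with s, t, u in the
  unit intervals numbered i, j, k, and \<open>axis2 i j\<close> is that of s < t alone. Almost every
  third point u falls after t, between s and t, or before s: these are the three terms.\<close>

lemma C_axis_shuffle:
  "(C_axis i j k + C_axis i k j + C_axis k i j :: 'a::field_char_0) = axis2 i j"
  by (cases i j rule: linorder_cases; cases j k rule: linorder_cases; cases i k rule: linorder_cases)
    (simp_all add: C_axis_def axis2_def)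

lemma axis2_symmetrize: "(axis2 i j + axis2 j i :: 'a::field_char_0) = 1"
  by (auto simp: axis2_def)

text \<open>Since (-1)^j = ((-1)^j - (-1)^(j+1))/2, the part beyond the diagonal telescopes, and the
  diagonal weight \<open>1 / 2\<close> cancels what depends on \<open>i\<close>.\<close>

lemma axis2_row_alternating:
  "i < m \<Longrightarrow> (\<Sum>j<m. axis2 i j * (- 1) ^ j) = - ((- 1) ^ m / (2 :: 'a::field_char_0))"
proof (induction m)
  case (Suc m)
  show ?case
  proof (cases "i = m")
    case True
    have "(\<Sum>j<m. axis2 i j * (- 1) ^ j) = (0 :: 'a)"
      by (rule sum.neutral) (auto simp: axis2_def True)
    then show ?thesis by (simp add: True axis2_def)
  next
    case False
    then show ?thesis using Suc by (simp add: axis2_def field_simps)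
  qed
qed simp

lemma axis2_column_sum:
  "j < m \<Longrightarrow> (\<Sum>i<m. axis2 i j) = (of_nat j + 1 / 2 :: 'a::field_char_0)"
proof -
  assume j: "j < m"
  have "(\<Sum>i<m. axis2 i j) = (\<Sum>i<Suc j. axis2 i j :: 'a)"
    by (rule sum.mono_neutral_right) (use j in \<open>auto simp: axis2_def\<close>)
  also have "\<dots> = (\<Sum>i<j. 1) + 1 / 2"
    by (simp add: axis2_def)
  finally show ?thesis by simp
qed

text \<open>This yields the inverse of the matrix of \<open>axis2\<close>, up to signs and a factor
  4. Below the diagonal all terms vanish; above it, \<open>axis2_row_alternating\<close> for length
  \<open>k\<close> cancels the half-weighted last term.\<close>

lemma axis2_alternating_axis2:
  assumes "i < m" "k < m"
  shows "(\<Sum>j<m. axis2 i j * (- 1) ^ j * axis2 j k) = (if i = k then (- 1) ^ i / (4 :: 'a::field_char_0) else 0)"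
proof -
  have "(\<Sum>j<m. axis2 i j * (- 1) ^ j * axis2 j k) = (\<Sum>j<Suc k. axis2 i j * (- 1) ^ j * axis2 j k :: 'a)"
    by (rule sum.mono_neutral_right) (use assms in \<open>auto simp: axis2_def\<close>)
  also have "\<dots> = (\<Sum>j<k. axis2 i j * (- 1) ^ j) + axis2 i k * (- 1) ^ k / 2"
    by (simp add: axis2_def)
  also have "\<dots> = (if i = k then (- 1) ^ i / 4 else 0)"
  proof (cases "i < k")
    case True
    then show ?thesis using axis2_row_alternating[OF True, where ?'a = 'a] by (simp add: axis2_def)
  next
    case False
    have "(\<Sum>j<k. axis2 i j * (- 1) ^ j) = (0 :: 'a)"
      by (rule sum.neutral) (use False in \<open>auto simp: axis2_def\<close>)
    with False show ?thesis by (auto simp: axis2_def)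
  qed
  finally show ?thesis .
qed

section \<open>Invariant tensors: slot permutations and contractions\<close>

definition invariant3 :: "nat \<Rightarrow> 'a::field tensor3 \<Rightarrow> (nat \<Rightarrow> nat \<Rightarrow> 'a) \<Rightarrow> bool" where
  "invariant3 m C x \<longleftrightarrow> (\<forall>\<alpha><m. \<forall>\<beta><m. \<forall>\<gamma><m.
     (\<Sum>i<m. \<Sum>j<m. \<Sum>k<m. C i j k * x \<alpha> i * x \<beta> j * x \<gamma> k) = C \<alpha> \<beta> \<gamma>)"

lemma invariant3D:
  "\<lbrakk>invariant3 m C x; \<alpha> < m; \<beta> < m; \<gamma> < m\<rbrakk> \<Longrightarrow>
     (\<Sum>i<m. \<Sum>j<m. \<Sum>k<m. C i j k * x \<alpha> i * x \<beta> j * x \<gamma> k) = C \<alpha> \<beta> \<gamma>"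
  by (simp add: invariant3_def)

lemma invariant3_add:
  assumes "invariant3 m C x" "invariant3 m D x"
  shows "invariant3 m (\<lambda>i j k. C i j k + D i j k) x"
  unfolding invariant3_def using assms by (simp add: invariant3D distrib_right sum.distrib)

lemma invariant3_scale:
  assumes "invariant3 m C x" and "a * a * a = 1"
  shows "invariant3 m C (\<lambda>\<alpha> i. a * x \<alpha> i)"
  unfolding invariant3_def
proof (intro allI impI)
  fix \<alpha> \<beta> \<gamma> assume *: "\<alpha> < m" "\<beta> < m" "\<gamma> < m"
  have "(\<Sum>i<m. \<Sum>j<m. \<Sum>k<m. C i j k * (a * x \<alpha> i) * (a * x \<beta> j) * (a * x \<gamma> k))
      = (a * a * a) * (\<Sum>i<m. \<Sum>j<m. \<Sum>k<m. C i j k * x \<alpha> i * x \<beta> j * x \<gamma> k)"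
    unfolding sum_distrib_left by (simp only: mult_ac)
  then show "(\<Sum>i<m. \<Sum>j<m. \<Sum>k<m. C i j k * (a * x \<alpha> i) * (a * x \<beta> j) * (a * x \<gamma> k)) = C \<alpha> \<beta> \<gamma>"
    using invariant3D[OF assms(1) *] assms(2) by simp
qed

lemma invariant3_swap12:
  assumes "invariant3 m C x"
  shows "invariant3 m (\<lambda>i j k. C j i k) x"
  unfolding invariant3_def
proof (intro allI impI)
  fix \<alpha> \<beta> \<gamma> assume *: "\<alpha> < m" "\<beta> < m" "\<gamma> < m"
  have "(\<Sum>i<m. \<Sum>j<m. \<Sum>k<m. C j i k * x \<alpha> i * x \<beta> j * x \<gamma> k)
      = (\<Sum>j<m. \<Sum>i<m. \<Sum>k<m. C j i k * x \<beta> j * x \<alpha> i * x \<gamma> k)"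
    by (subst sum.swap) (simp add: mult_ac)
  then show "(\<Sum>i<m. \<Sum>j<m. \<Sum>k<m. C j i k * x \<alpha> i * x \<beta> j * x \<gamma> k) = C \<beta> \<alpha> \<gamma>"
    using invariant3D[OF assms] * by simp
qed

lemma invariant3_swap23:
  assumes "invariant3 m C x"
  shows "invariant3 m (\<lambda>i j k. C i k j) x"
  unfolding invariant3_def
proof (intro allI impI)
  fix \<alpha> \<beta> \<gamma> assume *: "\<alpha> < m" "\<beta> < m" "\<gamma> < m"
  have "(\<Sum>j<m. \<Sum>k<m. C i k j * x \<alpha> i * x \<beta> j * x \<gamma> k)
      = (\<Sum>k<m. \<Sum>j<m. C i k j * x \<alpha> i * x \<gamma> k * x \<beta> j)" for i
    by (subst sum.swap) (simp add: mult_ac)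
  then show "(\<Sum>i<m. \<Sum>j<m. \<Sum>k<m. C i k j * x \<alpha> i * x \<beta> j * x \<gamma> k) = C \<alpha> \<gamma> \<beta>"
    using invariant3D[OF assms] * by simp
qed

text \<open>Pairing the middle slot with a vector fixed by the transpose of \<open>x\<close>
  collapses the sum over \<beta> to \<open>w j\<close>. What remains is a matrix invariant under
  congruence by \<open>x\<close>.\<close>

lemma invariant3_contract_mid:
  assumes inv: "invariant3 m C x" and \<alpha>: "\<alpha> < m" and \<gamma>: "\<gamma> < m"
    and w: "\<And>j. j < m \<Longrightarrow> (\<Sum>\<beta><m. w \<beta> * x \<beta> j) = w j"
  shows "(\<Sum>i<m. \<Sum>k<m. (\<Sum>j<m. C i j k * w j) * x \<alpha> i * x \<gamma> k) = (\<Sum>\<beta><m. C \<alpha> \<beta> \<gamma> * w \<beta>)"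
proof -
  have "(\<Sum>\<beta><m. C \<alpha> \<beta> \<gamma> * w \<beta>)
      = (\<Sum>\<beta><m. \<Sum>i<m. \<Sum>j<m. \<Sum>k<m. C i j k * x \<alpha> i * x \<gamma> k * (w \<beta> * x \<beta> j))"
  proof (rule sum.cong[OF refl])
    fix \<beta> assume "\<beta> \<in> {..<m}"
    then have eq: "C \<alpha> \<beta> \<gamma> = (\<Sum>i<m. \<Sum>j<m. \<Sum>k<m. C i j k * x \<alpha> i * x \<beta> j * x \<gamma> k)"
      using invariant3D[OF inv] \<alpha> \<gamma> by simp
    show "C \<alpha> \<beta> \<gamma> * w \<beta> = (\<Sum>i<m. \<Sum>j<m. \<Sum>k<m. C i j k * x \<alpha> i * x \<gamma> k * (w \<beta> * x \<beta> j))"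
      unfolding eq sum_distrib_right by (intro sum.cong refl) (simp add: mult_ac)
  qed
  also have "\<dots> = (\<Sum>i<m. \<Sum>\<beta><m. \<Sum>j<m. \<Sum>k<m. C i j k * x \<alpha> i * x \<gamma> k * (w \<beta> * x \<beta> j))"
    by (rule sum.swap)
  also have "\<dots> = (\<Sum>i<m. \<Sum>j<m. \<Sum>\<beta><m. \<Sum>k<m. C i j k * x \<alpha> i * x \<gamma> k * (w \<beta> * x \<beta> j))"
    by (rule sum.cong[OF refl], rule sum.swap)
  also have "\<dots> = (\<Sum>i<m. \<Sum>j<m. \<Sum>k<m. \<Sum>\<beta><m. C i j k * x \<alpha> i * x \<gamma> k * (w \<beta> * x \<beta> j))"
    by (rule sum.cong[OF refl], rule sum.cong[OF refl], rule sum.swap)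
  also have "\<dots> = (\<Sum>i<m. \<Sum>k<m. \<Sum>j<m. \<Sum>\<beta><m. C i j k * x \<alpha> i * x \<gamma> k * (w \<beta> * x \<beta> j))"
    by (rule sum.cong[OF refl], rule sum.swap)
  also have "\<dots> = (\<Sum>i<m. \<Sum>k<m. \<Sum>j<m. C i j k * x \<alpha> i * x \<gamma> k * w j)"
    by (rule sum.cong[OF refl])+ (simp add: sum_distrib_left[symmetric] w)
  also have "\<dots> = (\<Sum>i<m. \<Sum>k<m. (\<Sum>j<m. C i j k * w j) * x \<alpha> i * x \<gamma> k)"
    unfolding sum_distrib_right by (intro sum.cong refl) (simp add: mult_ac)
  finally show ?thesis ..
qed

text \<open>Pairing the last two slots with a diagonal form satisfying x^T diag(w) x = diag(w)
  leaves a vector fixed by \<open>x\<close>.\<close>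

lemma invariant3_contract_trace:
  assumes inv: "invariant3 m C x" and \<alpha>: "\<alpha> < m"
    and w: "\<And>j k. \<lbrakk>j < m; k < m\<rbrakk> \<Longrightarrow> (\<Sum>\<beta><m. w \<beta> * x \<beta> j * x \<beta> k) = (if j = k then w j else 0)"
  shows "(\<Sum>i<m. x \<alpha> i * (\<Sum>j<m. C i j j * w j)) = (\<Sum>\<beta><m. C \<alpha> \<beta> \<beta> * w \<beta>)"
proof -
  have "(\<Sum>\<beta><m. C \<alpha> \<beta> \<beta> * w \<beta>)
      = (\<Sum>\<beta><m. \<Sum>i<m. \<Sum>j<m. \<Sum>k<m. C i j k * x \<alpha> i * (w \<beta> * x \<beta> j * x \<beta> k))"
  proof (rule sum.cong[OF refl])
    fix \<beta> assume "\<beta> \<in> {..<m}"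
    then have eq: "C \<alpha> \<beta> \<beta> = (\<Sum>i<m. \<Sum>j<m. \<Sum>k<m. C i j k * x \<alpha> i * x \<beta> j * x \<beta> k)"
      using invariant3D[OF inv] \<alpha> by simp
    show "C \<alpha> \<beta> \<beta> * w \<beta> = (\<Sum>i<m. \<Sum>j<m. \<Sum>k<m. C i j k * x \<alpha> i * (w \<beta> * x \<beta> j * x \<beta> k))"
      unfolding eq sum_distrib_right by (intro sum.cong refl) (simp add: mult_ac)
  qed
  also have "\<dots> = (\<Sum>i<m. \<Sum>\<beta><m. \<Sum>j<m. \<Sum>k<m. C i j k * x \<alpha> i * (w \<beta> * x \<beta> j * x \<beta> k))"
    by (rule sum.swap)
  also have "\<dots> = (\<Sum>i<m. \<Sum>j<m. \<Sum>\<beta><m. \<Sum>k<m. C i j k * x \<alpha> i * (w \<beta> * x \<beta> j * x \<beta> k))"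
    by (rule sum.cong[OF refl], rule sum.swap)
  also have "\<dots> = (\<Sum>i<m. \<Sum>j<m. \<Sum>k<m. \<Sum>\<beta><m. C i j k * x \<alpha> i * (w \<beta> * x \<beta> j * x \<beta> k))"
    by (rule sum.cong[OF refl], rule sum.cong[OF refl], rule sum.swap)
  also have "\<dots> = (\<Sum>i<m. \<Sum>j<m. \<Sum>k<m. if j = k then C i j k * x \<alpha> i * w j else 0)"
    by (intro sum.cong refl) (simp add: sum_distrib_left[symmetric] w)
  also have "\<dots> = (\<Sum>i<m. x \<alpha> i * (\<Sum>j<m. C i j j * w j))"
    by (simp add: sum_distrib_left mult_ac)
  finally show ?thesis ..
qed

section \<open>Matrix congruence and commuting triangular matrices\<close>

lemma congruence_matrix_entry:
  fixes X M :: "'a::comm_ring_1 mat"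
  assumes "X \<in> carrier_mat m m" "M \<in> carrier_mat m m" "\<alpha> < m" "\<beta> < m"
  shows "(X * M * X\<^sup>T) $$ (\<alpha>, \<beta>) = (\<Sum>i<m. \<Sum>k<m. M $$ (i, k) * X $$ (\<alpha>, i) * X $$ (\<beta>, k))"
  using assms by (simp add: scalar_prod_def lessThan_atLeast0 sum_distrib_left sum_distrib_right mult_ac)

text \<open>Strictly lower entries of \<open>X\<close> are cleared from the bottom left corner,
  where the measure \<open>m - i + j\<close> is smallest. In entry \<open>(i, j)\<close> of the
  commutation relation all other terms vanish by triangularity of \<open>U\<close> or by induction,
  leaving \<open>X $$ (i, j)\<close> times a difference of distinct diagonal entries of
  \<open>U\<close>.\<close>

lemma commutes_upper_triangular_imp_upper_triangular:
  fixes U X :: "'a::field mat"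
  assumes X: "X \<in> carrier_mat m m" and U: "U \<in> carrier_mat m m"
    and comm: "X * U = U * X" and tri: "upper_triangular U"
    and inj: "inj_on (\<lambda>i. U $$ (i, i)) {..<m}"
  shows "upper_triangular X"
proof -
  have "X $$ (i, j) = 0" if "i < m" "j < i" for i j
    using that
  proof (induction "m - i + j" arbitrary: i j rule: less_induct)
    case less
    have "(\<Sum>k<m. X $$ (i, k) * U $$ (k, j)) = (\<Sum>k<m. U $$ (i, k) * X $$ (k, j))"
      using arg_cong[OF comm, of "\<lambda>A. A $$ (i, j)"] X U less.prems
      by (simp add: scalar_prod_def lessThan_atLeast0)
    moreover have "(\<Sum>k<m. X $$ (i, k) * U $$ (k, j)) = (\<Sum>k\<in>{j}. X $$ (i, k) * U $$ (k, j))"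
    proof (rule sum.mono_neutral_right)
      show "\<forall>k\<in>{..<m} - {j}. X $$ (i, k) * U $$ (k, j) = 0"
      proof
        fix k assume "k \<in> {..<m} - {j}"
        then consider "k < j" | "j < k" "k < m" by force
        then show "X $$ (i, k) * U $$ (k, j) = 0"
          by cases (use less U upper_triangularD[OF tri] in auto)
      qed
    qed (use less.prems in auto)
    moreover have "(\<Sum>k<m. U $$ (i, k) * X $$ (k, j)) = (\<Sum>k\<in>{i}. U $$ (i, k) * X $$ (k, j))"
    proof (rule sum.mono_neutral_right)
      show "\<forall>k\<in>{..<m} - {i}. U $$ (i, k) * X $$ (k, j) = 0"
      proof
        fix k assume "k \<in> {..<m} - {i}"
        then consider "k < i" | "i < k" "k < m" by force
        then show "U $$ (i, k) * X $$ (k, j) = 0"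
          by cases (use less U upper_triangularD[OF tri] in auto)
      qed
    qed (use less.prems in auto)
    ultimately have "X $$ (i, j) * U $$ (j, j) = U $$ (i, i) * X $$ (i, j)"
      by simp
    moreover have "U $$ (j, j) \<noteq> U $$ (i, i)"
      using inj_onD[OF inj, of j i] less.prems by auto
    ultimately show ?case by (metis mult.commute mult_left_cancel)
  qed
  then show ?thesis using X by (intro upper_triangularI) auto
qed

text \<open>A nondegenerate invariant form \<open>G\<close> turns another invariant form
  \<open>P * G\<close> into a commuting operator: the common right factor G X^T of X P G X^T = P X G
  X^T is cancelled.\<close>

lemma commutes_of_congruence_invariant:
  fixes X :: "'a::comm_ring_1 mat"
  assumes [simp]: "X \<in> carrier_mat m m" "Z \<in> carrier_mat m m" "G \<in> carrier_mat m m"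
      "H \<in> carrier_mat m m" "P \<in> carrier_mat m m"
    and ZX: "Z * X = 1\<^sub>m m" and GH: "G * H = 1\<^sub>m m"
    and G: "X * G * X\<^sup>T = G" and PG: "X * (P * G) * X\<^sup>T = P * G"
  shows "X * P = P * X"
proof -
  note assoc = assoc_mult_mat[of _ m m _ m _ m] mult_carrier_mat[of _ m m _ m]
    left_mult_one_mat[of _ m m] right_mult_one_mat[of _ m m]
  have XZ: "X\<^sup>T * Z\<^sup>T = 1\<^sub>m m"
    using arg_cong[OF ZX, of transpose_mat] by (simp add: transpose_mult[of _ m m _ m])
  have "X * (P * G) * X\<^sup>T = P * (X * G * X\<^sup>T)"
    by (simp only: G PG)
  then have "X * (P * G) * X\<^sup>T * Z\<^sup>T * H = P * (X * G * X\<^sup>T) * Z\<^sup>T * H"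
    by simp
  then have "X * (P * (G * ((X\<^sup>T * Z\<^sup>T) * H))) = P * (X * (G * ((X\<^sup>T * Z\<^sup>T) * H)))"
    by (simp add: assoc)
  then show ?thesis by (simp add: XZ GH assoc)
qed

lemma invariant3_contract_mid_matrix:
  assumes inv: "invariant3 m C (\<lambda>\<alpha> i. X $$ (\<alpha>, i))" and X: "X \<in> carrier_mat m m"
    and w: "\<And>j. j < m \<Longrightarrow> (\<Sum>\<beta><m. w \<beta> * X $$ (\<beta>, j)) = w j"
    and M: "M = mat m m (\<lambda>(i, k). \<Sum>j<m. C i j k * w j)"
  shows "X * M * X\<^sup>T = M"
proof (rule eq_matI)
  fix \<alpha> \<gamma> assume "\<alpha> < dim_row M" "\<gamma> < dim_col M"
  then have *: "\<alpha> < m" "\<gamma> < m" by (simp_all add: M)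
  have "(X * M * X\<^sup>T) $$ (\<alpha>, \<gamma>) = (\<Sum>i<m. \<Sum>k<m. M $$ (i, k) * X $$ (\<alpha>, i) * X $$ (\<gamma>, k))"
    by (rule congruence_matrix_entry[OF X _ *]) (simp add: M)
  also have "\<dots> = (\<Sum>i<m. \<Sum>k<m. (\<Sum>j<m. C i j k * w j) * X $$ (\<alpha>, i) * X $$ (\<gamma>, k))"
    by (intro sum.cong refl) (simp add: M)
  also have "\<dots> = M $$ (\<alpha>, \<gamma>)"
    using * by (simp add: M invariant3_contract_mid[OF inv * w])
  finally show "(X * M * X\<^sup>T) $$ (\<alpha>, \<gamma>) = M $$ (\<alpha>, \<gamma>)" .
next
  show "dim_row (X * M * X\<^sup>T) = dim_row M" "dim_col (X * M * X\<^sup>T) = dim_col M"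
    using X by (simp_all add: M)
qed

section \<open>Consequences of the invariance of the core tensor\<close>

text \<open>Permuting slots preserves invariance, so the shuffle relation applies. The third index
  stays as a dummy to keep the tensor format.\<close>

lemma C_axis_invariant_axis2:
  assumes "invariant3 m (C_axis :: 'a::field_char_0 tensor3) x"
  shows "invariant3 m (\<lambda>i j k. axis2 i j) x"
  using invariant3_add[OF invariant3_add[OF assms invariant3_swap23[OF assms]]
      invariant3_swap23[OF invariant3_swap12[OF assms]]]
  by (simp only: C_axis_shuffle)

text \<open>Symmetrizing \<open>axis2\<close> gives the constant tensor 1, on which the congruence
  action factors into row sums.\<close>

lemma C_axis_invariant_row_sums:
  assumes inv: "invariant3 m (C_axis :: 'a::field_char_0 tensor3) x"
    and "\<alpha> < m" "\<beta> < m" "\<gamma> < m"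
  shows "(\<Sum>i<m. x \<alpha> i) * (\<Sum>j<m. x \<beta> j) * (\<Sum>k<m. x \<gamma> k) = 1"
proof -
  have "invariant3 m (\<lambda>i j k. 1) x"
    using invariant3_add[OF C_axis_invariant_axis2[OF inv] invariant3_swap12[OF C_axis_invariant_axis2[OF inv]]]
    by (simp only: axis2_symmetrize)
  from invariant3D[OF this assms(2-4)] show ?thesis
    by (simp only: mult_1 flip: sum_distrib_left sum_distrib_right)
qed

lemma C_axis_invariant_imp_one:
  fixes X Z :: "'a::field_char_0 mat"
  assumes X [simp]: "X \<in> carrier_mat m m" and Z [simp]: "Z \<in> carrier_mat m m"
    and XZ: "X * Z = 1\<^sub>m m" and ZX: "Z * X = 1\<^sub>m m"
    and inv: "invariant3 m C_axis (\<lambda>\<alpha> i. X $$ (\<alpha>, i))"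
    and rows: "\<And>\<alpha>. \<alpha> < m \<Longrightarrow> (\<Sum>i<m. X $$ (\<alpha>, i)) = 1"
  shows "X = 1\<^sub>m m"
proof -
  note assoc = assoc_mult_mat[of _ m m _ m _ m] mult_carrier_mat[of _ m m _ m]
    left_mult_one_mat[of _ m m] right_mult_one_mat[of _ m m]
  note assocv = assoc_mult_mat_vec[of _ m m _ m]
  note [simp] = carrier_matD[OF X]
  define d where "d i = (- 1 :: 'a) ^ i" for i :: nat
  have dd [simp]: "d i * d i = 1" for i
    by (simp add: d_def flip: power_add)
  define c where "c = - ((- 1) ^ m / (2 :: 'a))"
  define one where "one = vec m (\<lambda>_. 1 :: 'a)"
  define dv where "dv = vec m d"
  define G where "G = mat m m (\<lambda>(i, j). axis2 i j :: 'a)"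
  define D where "D = mat_diag m d"
  \<comment> \<open>The inverse of \<open>G\<close>: as G D G = D / 4, the product of G and 4 D G D
    is 4 (D / 4) D = I.\<close>
  define H where "H = D * G * mat_diag m (\<lambda>i. 4 * d i)"
  have [simp]: "one \<in> carrier_vec m" "dv \<in> carrier_vec m" "G \<in> carrier_mat m m" "D \<in> carrier_mat m m"
    by (simp_all add: one_def dv_def G_def D_def)
  then have [simp]: "H \<in> carrier_mat m m"
    by (simp add: H_def assoc)
  have DD: "D * D = 1\<^sub>m m"
    by (simp add: D_def)
  have GDG: "G * mat_diag m (\<lambda>i. a * d i) * G = mat_diag m (\<lambda>i. a / 4 * d i)" for a
  proof (rule eq_matI)
    fix i k assume "i < dim_row (mat_diag m (\<lambda>i. a / 4 * d i))" "k < dim_col (mat_diag m (\<lambda>i. a / 4 * d i))"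
    then have *: "i < m" "k < m" by (simp_all add: mat_diag_def)
    have "(G * mat_diag m (\<lambda>i. a * d i) * G) $$ (i, k) = a * (\<Sum>j<m. axis2 i j * (- 1) ^ j * axis2 j k)"
      using * by (simp add: mat_diag_mult_right[of _ m] G_def scalar_prod_def lessThan_atLeast0 d_def
          sum_distrib_left mult_ac)
    then show "(G * mat_diag m (\<lambda>i. a * d i) * G) $$ (i, k) = mat_diag m (\<lambda>i. a / 4 * d i) $$ (i, k)"
      using * axis2_alternating_axis2[OF *, where ?'a = 'a] by (simp add: mat_diag_def d_def)
  qed (simp_all add: G_def mat_diag_def)
  have HG: "H * G = 1\<^sub>m m"
  proof -
    have "H * G = D * (G * mat_diag m (\<lambda>i. 4 * d i) * G)"
      by (simp add: H_def assoc)
    then show ?thesis by (simp add: GDG DD flip: D_def)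
  qed
  have GH: "G * H = 1\<^sub>m m"
  proof -
    have "G * H = (G * mat_diag m (\<lambda>i. 1 * d i) * G) * mat_diag m (\<lambda>i. 4 * d i)"
      by (simp add: H_def D_def assoc)
    then show ?thesis by (simp only: GDG) simp
  qed

  have X_one: "X *\<^sub>v one = one"
    by (rule eq_vecI) (use X rows in \<open>auto simp: one_def scalar_prod_def lessThan_atLeast0\<close>)
  have G_dv: "G *\<^sub>v dv = c \<cdot>\<^sub>v one"
    by (rule eq_vecI) (use axis2_row_alternating[where ?'a = 'a] in
        \<open>auto simp: G_def dv_def one_def c_def d_def scalar_prod_def lessThan_atLeast0\<close>)

  have G: "X * G * X\<^sup>T = G"
  proof (rule eq_matI)
    fix \<alpha> \<beta> assume "\<alpha> < dim_row G" "\<beta> < dim_col G"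
    then have *: "\<alpha> < m" "\<beta> < m" by (simp_all add: G_def)
    \<comment> \<open>The third slot contributes only the row sum at its index, which is 1, so any
      index will do; \<alpha> is at hand.\<close>
    have "(\<Sum>i<m. \<Sum>j<m. axis2 i j * X $$ (\<alpha>, i) * X $$ (\<beta>, j) * (\<Sum>k<m. X $$ (\<alpha>, k))) = axis2 \<alpha> \<beta>"
      using invariant3D[OF C_axis_invariant_axis2[OF inv] * *(1)]
      by (simp only: sum_distrib_left)
    then show "(X * G * X\<^sup>T) $$ (\<alpha>, \<beta>) = G $$ (\<alpha>, \<beta>)"
      using * by (subst congruence_matrix_entry[OF X]) (simp_all add: rows, simp_all add: G_def)
  qed (use X in \<open>auto simp: G_def\<close>)

  have XT_dv: "X\<^sup>T *\<^sub>v dv = dv"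
  proof -
    \<comment> \<open>Solving X G X^T = G gives X^T = G^(-1) X^(-1) G. This fixes d because G d is a
      multiple of the all-ones vector, which \<open>X\<close> and hence \<open>Z\<close>
      fix.\<close>
    have "X\<^sup>T = (H * ((Z * X) * G)) * X\<^sup>T"
      by (simp add: ZX HG assoc)
    also have "\<dots> = H * (Z * (X * G * X\<^sup>T))"
      by (simp add: assoc)
    finally have "X\<^sup>T = H * (Z * G)"
      by (simp only: G)
    then have "X\<^sup>T *\<^sub>v dv = H *\<^sub>v (Z *\<^sub>v (G *\<^sub>v dv))"
      by (simp add: assocv assoc)
    also have "Z *\<^sub>v (G *\<^sub>v dv) = c \<cdot>\<^sub>v ((Z * X) *\<^sub>v one)"
      by (simp add: G_dv mult_mat_vec[of _ m m] assocv X_one)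
    also have "\<dots> = G *\<^sub>v dv"
      by (simp add: ZX G_dv)
    also have "H *\<^sub>v \<dots> = (H * G) *\<^sub>v dv"
      by (simp add: assocv)
    finally show ?thesis by (simp add: HG)
  qed
  have col_d: "(\<Sum>\<beta><m. d \<beta> * X $$ (\<beta>, j)) = d j" if "j < m" for j
    using arg_cong[OF XT_dv, of "\<lambda>v. v $ j"] that X
    by (simp add: dv_def scalar_prod_def lessThan_atLeast0 mult_ac)

  \<comment> \<open>The weight 6 normalizes: contracting with d gives G D G - D / 12 = D / 4 - D /
    12 = D / 6.\<close>
  have D_alt: "D = mat m m (\<lambda>(i, k). \<Sum>j<m. C_axis i j k * (6 * d j))"
  proof (rule eq_matI)
    fix i k
    assume "i < dim_row (mat m m (\<lambda>(i, k). \<Sum>j<m. C_axis i j k * (6 * d j)))"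
      "k < dim_col (mat m m (\<lambda>(i, k). \<Sum>j<m. C_axis i j k * (6 * d j)))"
    then have *: "i < m" "k < m" by simp_all
    have "(\<Sum>j<m. C_axis i j k * (6 * d j))
        = 6 * (\<Sum>j<m. axis2 i j * (- 1) ^ j * axis2 j k) - (\<Sum>j<m. if i = j then (if j = k then d j / 2 else 0) else 0)"
      unfolding sum_distrib_left sum_subtractf[symmetric]
      by (rule sum.cong) (auto simp: C_axis_eq_axis2 d_def algebra_simps)
    also have "\<dots> = (if i = k then d k else 0)"
      using * by (simp add: axis2_alternating_axis2 d_def)
    finally show "D $$ (i, k) = mat m m (\<lambda>(i, k). \<Sum>j<m. C_axis i j k * (6 * d j)) $$ (i, k)"
      using * by (simp add: D_def mat_diag_def)
  qed (simp_all add: D_def mat_diag_def)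
  have D: "X * D * X\<^sup>T = D"
    by (rule invariant3_contract_mid_matrix[OF inv X _ D_alt])
      (simp add: col_d mult.assoc flip: sum_distrib_left)
  have Z_eq: "Z = D * X\<^sup>T * D"
  proof -
    have "Z = Z * ((X * D * X\<^sup>T) * D)"
      by (simp add: D DD assoc)
    also have "\<dots> = (Z * X) * (D * X\<^sup>T * D)"
      by (simp add: assoc)
    finally show ?thesis by (simp add: ZX assoc)
  qed
  have D': "X\<^sup>T * D * X = D"
  proof -
    have "X\<^sup>T * D * X = (D * D) * (X\<^sup>T * D * X)"
      by (simp add: DD assoc)
    also have "\<dots> = D * (Z * X)"
      by (simp add: Z_eq assoc)
    finally show ?thesis by (simp add: ZX assoc)
  qed

  have row_d: "(\<Sum>i<m. X $$ (\<alpha>, i) * d i) = d \<alpha>" if \<alpha>: "\<alpha> < m" for \<alpha>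
  proof -
    \<comment> \<open>The contraction is half of G d minus d / 12. Unit row sums already preserve
      its constant part \<open>c / 2\<close>, which isolates d.\<close>
    have trace: "(\<Sum>j<m. C_axis i j j * d j) = c / 2 - d i / 12" if "i < m" for i
    proof -
      have "(\<Sum>j<m. C_axis i j j * d j)
          = (\<Sum>j<m. axis2 i j * (- 1) ^ j) / 2 - (\<Sum>j<m. if i = j then d j / 12 else 0)"
        unfolding sum_divide_distrib sum_subtractf[symmetric]
        by (rule sum.cong) (auto simp: C_axis_eq_axis2 axis2_def d_def algebra_simps)
      then show ?thesis
        using that by (simp add: axis2_row_alternating c_def)
    qed
    have "(\<Sum>\<beta><m. d \<beta> * X $$ (\<beta>, j) * X $$ (\<beta>, k)) = (if j = k then d j else 0)"
      if "j < m" "k < m" for j k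
    proof -
      have "(X\<^sup>T * D * X) $$ (j, k) = (\<Sum>\<beta><m. d \<beta> * X $$ (\<beta>, j) * X $$ (\<beta>, k))"
        using that X by (simp add: D_def mat_diag_mult_right[of _ m] scalar_prod_def lessThan_atLeast0 mult_ac)
      moreover have "D $$ (j, k) = (if j = k then d j else 0)"
        using that by (simp add: D_def mat_diag_def)
      ultimately show ?thesis by (simp only: D')
    qed
    from invariant3_contract_trace[OF inv \<alpha> this]
    have "(\<Sum>i<m. X $$ (\<alpha>, i) * (c / 2 - d i / 12)) = c / 2 - d \<alpha> / 12"
      using \<alpha> by (simp add: trace)
    moreover have "(\<Sum>i<m. X $$ (\<alpha>, i) * (c / 2 - d i / 12))
        = (\<Sum>i<m. X $$ (\<alpha>, i)) * (c / 2) - (\<Sum>i<m. X $$ (\<alpha>, i) * d i) / 12"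
      by (simp add: right_diff_distrib sum_subtractf sum_distrib_right sum_divide_distrib)
    ultimately show ?thesis using rows[OF \<alpha>] by simp
  qed
  have X_dv: "X *\<^sub>v dv = dv"
    by (rule eq_vecI) (use X row_d in \<open>auto simp: dv_def scalar_prod_def lessThan_atLeast0\<close>)
  have D_dv: "D *\<^sub>v dv = one"
    by (rule eq_vecI) (auto simp: D_def dv_def one_def mat_diag_def scalar_prod_def if_distrib[of "\<lambda>a. a * _"] cong: if_cong)
  have XT_one: "X\<^sup>T *\<^sub>v one = one"
  proof -
    have "X\<^sup>T *\<^sub>v one = X\<^sup>T *\<^sub>v (D *\<^sub>v (X *\<^sub>v dv))"
      by (simp add: D_dv X_dv)
    also have "\<dots> = (X\<^sup>T * D * X) *\<^sub>v dv"
      by (simp add: assocv assoc)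
    finally show ?thesis by (simp add: D' D_dv)
  qed
  have col_one: "(\<Sum>\<beta><m. 1 * X $$ (\<beta>, j)) = 1" if "j < m" for j
    using arg_cong[OF XT_one, of "\<lambda>v. v $ j"] that X
    by (simp add: one_def scalar_prod_def lessThan_atLeast0 mult_ac)

  \<comment> \<open>Contracting the first slot with ones gives Q = diag(i + 1/2) G - I / 12, the
    diagonal holding the column sums of \<open>G\<close>. Then P = Q G^(-1), since G^(-1) / 12 = D G
    D / 3.\<close>
  define P where "P = mat m m (\<lambda>(i, j). (if i = j then of_nat i + 1 / 2 else 0) - d i * axis2 i j * d j / 3)"
  have P [simp]: "P \<in> carrier_mat m m" by (simp add: P_def)
  have PG_eq: "P * G = mat m m (\<lambda>(i, k). \<Sum>j<m. C_axis j i k * 1)"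
  proof -
    have "mat_diag m (\<lambda>_. 1 / 12) * H = mat m m (\<lambda>(i, j). d i * axis2 i j * d j / 3)"
      by (rule eq_matI) (auto simp: H_def D_def G_def mat_diag_mult_left[of _ m m] mat_diag_mult_right[of _ m m])
    then have "P = mat_diag m (\<lambda>i. of_nat i + 1 / 2) - mat_diag m (\<lambda>_. 1 / 12) * H"
      by (intro eq_matI) (auto simp: P_def mat_diag_def)
    then have "P * G = mat_diag m (\<lambda>i. of_nat i + 1 / 2) * G - mat_diag m (\<lambda>_. 1 / 12) * (H * G)"
      by (simp add: minus_mult_distrib_mat[of _ m m _ _ m] assoc)
    also have "\<dots> = mat_diag m (\<lambda>i. of_nat i + 1 / 2) * G - mat_diag m (\<lambda>_. 1 / 12)"
      by (simp add: HG assoc)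
    also have "\<dots> = mat m m (\<lambda>(i, k). \<Sum>j<m. C_axis j i k * 1)"
    proof (rule eq_matI)
      fix i k assume "i < dim_row (mat m m (\<lambda>(i, k). \<Sum>j<m. C_axis j i k * 1 :: 'a))"
        "k < dim_col (mat m m (\<lambda>(i, k). \<Sum>j<m. C_axis j i k * 1 :: 'a))"
      then have *: "i < m" "k < m" by simp_all
      have "(\<Sum>j<m. C_axis j i k * 1)
          = (\<Sum>j<m. axis2 j i) * axis2 i k - (\<Sum>j<m. if j = i then (if i = k then 1 / 12 else 0) else 0 :: 'a)"
        unfolding sum_distrib_right sum_subtractf[symmetric]
        by (rule sum.cong) (auto simp: C_axis_eq_axis2)
      then show "(mat_diag m (\<lambda>i. of_nat i + 1 / 2) * G - mat_diag m (\<lambda>_. 1 / 12)) $$ (i, k)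
          = mat m m (\<lambda>(i, k). \<Sum>j<m. C_axis j i k * 1) $$ (i, k)"
        using * by (simp add: mat_diag_mult_left[of _ m m] axis2_column_sum) (simp add: G_def mat_diag_def)
    qed (simp_all add: G_def mat_diag_def)
    finally show ?thesis .
  qed
  \<comment> \<open>\<open>invariant3_swap12\<close> moves the first slot to the middle, where the
    contraction lemma applies with weight 1.\<close>
  have XP: "X * P = P * X"
    by (rule commutes_of_congruence_invariant[OF X Z _ _ P ZX GH G])
      (simp_all add: invariant3_contract_mid_matrix[OF invariant3_swap12[OF inv] X col_one PG_eq])

  \<comment> \<open>The correction on the diagonal is (1/2) / 3 = 1/6, and the values i + 1/3 are
    distinct in characteristic 0.\<close>
  have P_diag: "P $$ (i, i) = of_nat i + 1 / 3" if "i < m" for i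
    using that by (simp add: P_def axis2_def)
  have P_upper: "upper_triangular P"
    by (rule upper_triangularI) (simp add: P_def axis2_def)
  have DPD: "D * P * D = mat m m (\<lambda>(i, j). d i * P $$ (i, j) * d j)"
    by (rule eq_matI)
      (simp_all add: D_def mat_diag_mult_left[of _ m m] mat_diag_mult_right[of _ m m] carrier_matD[OF P])
  have X_upper: "upper_triangular X"
    by (rule commutes_upper_triangular_imp_upper_triangular[OF X P XP P_upper])
      (auto simp: inj_on_def P_diag)
  have XT_upper: "upper_triangular (X\<^sup>T)"
  \<comment> \<open>\<open>Z\<close> commutes with \<open>P\<close> as \<open>X\<close> does, and
    X^T = D Z D, so X^T commutes with D P D. Conjugation by the sign matrix \<open>D\<close> keeps
    both the triangular shape and the diagonal of \<open>P\<close>.\<close>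
  proof (rule commutes_upper_triangular_imp_upper_triangular[of _ m "D * P * D"])
    have "Z * P = Z * (P * X) * Z"
      by (simp add: assoc XZ)
    also have "\<dots> = (Z * X) * (P * Z)"
      by (simp add: assoc flip: XP)
    finally have ZP: "Z * P = P * Z"
      by (simp add: ZX assoc)
    have XT: "X\<^sup>T = D * Z * D"
    proof -
      have "D * Z * D = (D * D) * X\<^sup>T * (D * D)"
        by (simp add: Z_eq assoc)
      then show ?thesis by (simp add: DD assoc)
    qed
    have "X\<^sup>T * (D * P * D) = D * (Z * ((D * D) * (P * D)))"
      by (simp add: XT assoc)
    also have "\<dots> = D * (Z * P) * D"
      by (simp add: DD assoc)
    also have "\<dots> = D * (P * ((D * D) * (Z * D)))"
      by (simp add: ZP DD assoc)
    also have "\<dots> = (D * P * D) * X\<^sup>T"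
      by (simp add: XT assoc)
    finally show "X\<^sup>T * (D * P * D) = (D * P * D) * X\<^sup>T" .
    show "upper_triangular (D * P * D)"
      unfolding DPD using upper_triangularD[OF P_upper]
      by (intro upper_triangularI) (simp add: carrier_matD[OF P])
    show "inj_on (\<lambda>i. (D * P * D) $$ (i, i)) {..<m}"
      unfolding DPD by (rule inj_onI) (simp add: P_diag mult.commute flip: mult.assoc)
  qed (simp_all add: assoc)
  show ?thesis
  proof (rule eq_matI)
    fix i j assume "i < dim_row (1\<^sub>m m :: 'a mat)" "j < dim_col (1\<^sub>m m :: 'a mat)"
    then have *: "i < m" "j < m" by simp_all
    have off: "X $$ (i, k) = 0" if "k < m" "k \<noteq> i" for k
      using that * upper_triangularD[OF X_upper, of k i] upper_triangularD[OF XT_upper, of i k]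
      by (cases "k < i") simp_all
    have "(\<Sum>k<m. X $$ (i, k)) = (\<Sum>k\<in>{i}. X $$ (i, k))"
      by (rule sum.mono_neutral_right) (use off * in auto)
    then have "X $$ (i, i) = 1"
      using rows * by simp
    then show "X $$ (i, j) = 1\<^sub>m m $$ (i, j)"
      using off * by (cases "i = j") auto
  qed simp_all
qed

section \<open>Scalar matrices and the reduction to unit row sums\<close>

text \<open>Each term of the trilinear action picks up \<open>\<eta> ^ 3\<close>, whatever the
  tensor, and \<open>\<eta> ^ 2\<close> inverts \<eta>.\<close>

lemma smult_one_in_stabilizer:
  fixes \<eta> :: "'a::field"
  assumes \<eta>: "\<eta> ^ 3 = 1"
  shows "\<eta> \<cdot>\<^sub>m 1\<^sub>m m \<in> stabilizer m C"
proof -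
  have \<eta>': "\<eta> * \<eta> ^ 2 = 1"
    using \<eta> by (simp add: power3_eq_cube power2_eq_square mult.assoc)
  have "(\<eta> \<cdot>\<^sub>m 1\<^sub>m m) * (\<eta> ^ 2 \<cdot>\<^sub>m 1\<^sub>m m) = 1\<^sub>m m" "(\<eta> ^ 2 \<cdot>\<^sub>m 1\<^sub>m m) * (\<eta> \<cdot>\<^sub>m 1\<^sub>m m) = 1\<^sub>m m"
    by (rule eq_matI; simp add: \<eta>' mult.commute[of "\<eta> ^ 2"])+
  then have "invertible_mat (\<eta> \<cdot>\<^sub>m 1\<^sub>m m)"
    unfolding invertible_mat_def inverts_mat_def by auto
  moreover have "congruence m C (\<eta> \<cdot>\<^sub>m 1\<^sub>m m) \<alpha> \<beta> \<gamma> = C \<alpha> \<beta> \<gamma>" if "\<alpha> < m" "\<beta> < m" "\<gamma> < m" for \<alpha> \<beta> \<gamma>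
  proof -
    have "congruence m C (\<eta> \<cdot>\<^sub>m 1\<^sub>m m) \<alpha> \<beta> \<gamma>
        = (\<Sum>i<m. \<Sum>j<m. \<Sum>k<m. if \<gamma> = k then if \<beta> = j then if \<alpha> = i then C i j k * \<eta> ^ 3 else 0 else 0 else 0)"
      unfolding congruence_def using that
      by (intro sum.cong refl) (simp add: power3_eq_cube mult.assoc)
    with that show ?thesis by (simp add: \<eta>)
  qed
  ultimately show ?thesis
    by (simp add: stabilizer_def GL_def eq_tensor3_def)
qed

lemma stabilizer_C_axis:
  "stabilizer m (C_axis :: 'a::field_char_0 tensor3) = {\<eta> \<cdot>\<^sub>m 1\<^sub>m m | \<eta>. \<eta> ^ 3 = 1}"
proof (intro equalityI subsetI)
  fix X :: "'a mat" assume stab: "X \<in> stabilizer m C_axis"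
  then have X [simp]: "X \<in> carrier_mat m m" and "invertible_mat X"
    and inv: "invariant3 m C_axis (\<lambda>\<alpha> i. X $$ (\<alpha>, i))"
    by (auto simp: stabilizer_def GL_def eq_tensor3_def congruence_def invariant3_def)
  note [simp] = carrier_matD[OF X]
  obtain Z where XZ: "X * Z = 1\<^sub>m m" and "Z * X = 1\<^sub>m (dim_row Z)"
    using \<open>invertible_mat X\<close> by (auto simp: invertible_mat_def inverts_mat_def)
  \<comment> \<open>\<open>invertible_mat\<close> leaves the shape of the inverse open; it is read
    off from the two products.\<close>
  moreover have dims: "dim_row Z = m" "dim_col Z = m"
    using arg_cong[OF \<open>Z * X = _\<close>, of dim_col] arg_cong[OF XZ, of dim_col] by simp_all
  ultimately have ZX: "Z * X = 1\<^sub>m m" by simp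
  have Z [simp]: "Z \<in> carrier_mat m m" using dims by auto
  define r where "r \<alpha> = (\<Sum>i<m. X $$ (\<alpha>, i))" for \<alpha>
  have r: "r \<alpha> * r \<beta> * r \<gamma> = 1" if "\<alpha> < m" "\<beta> < m" "\<gamma> < m" for \<alpha> \<beta> \<gamma>
    unfolding r_def by (rule C_axis_invariant_row_sums[OF inv that])
  show "X \<in> {\<eta> \<cdot>\<^sub>m 1\<^sub>m m | \<eta>. \<eta> ^ 3 = 1}"
  proof (cases "m = 0")
    \<comment> \<open>Without rows there is no row sum to supply \<eta>; the empty matrix is covered
      by \<eta> = 1.\<close>
    case True
    have "X = 1 \<cdot>\<^sub>m 1\<^sub>m m" by (rule eq_matI) (use True in auto)
    then show ?thesis by force
  next
    case False
    \<comment> \<open>Any three row sums have product 1, so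
      \<open>r \<alpha> * r 0 * r 0 = 1\<close> for each row. Scaling by \<open>\<eta> ^ 2\<close>,
      the inverse of \<eta>, thus makes every row sum 1.\<close>
    define \<eta> where "\<eta> = r 0"
    have \<eta>: "\<eta> ^ 3 = 1"
      using r[of 0 0 0] False by (simp add: \<eta>_def power3_eq_cube)
    have \<eta>': "\<eta> * \<eta> ^ 2 = 1" "\<eta> ^ 2 * \<eta> = 1"
      using \<eta> by (simp_all add: power3_eq_cube power2_eq_square mult.assoc)
    have smult_smult: "a \<cdot>\<^sub>m (b \<cdot>\<^sub>m A) = (a * b) \<cdot>\<^sub>m A" for a b :: 'a and A
      by (rule eq_matI) (simp_all add: mult.assoc)
    have one_smult: "1 \<cdot>\<^sub>m A = A" for A :: "'a mat"
      by (rule eq_matI) simp_all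
    have "\<eta> ^ 2 \<cdot>\<^sub>m X = 1\<^sub>m m"
    proof (rule C_axis_invariant_imp_one)
      show "\<eta> ^ 2 \<cdot>\<^sub>m X \<in> carrier_mat m m" "\<eta> \<cdot>\<^sub>m Z \<in> carrier_mat m m"
        by simp_all
      show "(\<eta> ^ 2 \<cdot>\<^sub>m X) * (\<eta> \<cdot>\<^sub>m Z) = 1\<^sub>m m" "(\<eta> \<cdot>\<^sub>m Z) * (\<eta> ^ 2 \<cdot>\<^sub>m X) = 1\<^sub>m m"
        by (simp_all add: mult_smult_assoc_mat[of _ m m _ m] mult_smult_distrib[of _ m m _ m] smult_smult one_smult XZ ZX \<eta>')
      have "\<eta> ^ 2 * \<eta> ^ 2 * \<eta> ^ 2 = 1"
        using \<eta>' by (metis mult.assoc mult.left_neutral power2_eq_square)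
      from invariant3_scale[OF inv this]
      show "invariant3 m C_axis (\<lambda>\<alpha> i. (\<eta> ^ 2 \<cdot>\<^sub>m X) $$ (\<alpha>, i))"
        by (simp add: invariant3_def)
      show "(\<Sum>i<m. (\<eta> ^ 2 \<cdot>\<^sub>m X) $$ (\<alpha>, i)) = 1" if "\<alpha> < m" for \<alpha>
      proof -
        have "(\<Sum>i<m. (\<eta> ^ 2 \<cdot>\<^sub>m X) $$ (\<alpha>, i)) = \<eta> ^ 2 * r \<alpha>"
          using that by (simp add: r_def flip: sum_distrib_left)
        also have "\<dots> = r \<alpha> * r 0 * r 0"
          by (simp add: \<eta>_def power2_eq_square mult_ac)
        finally show ?thesis using r that False by simp
      qed
    qed
    then have "\<eta> \<cdot>\<^sub>m (\<eta> ^ 2 \<cdot>\<^sub>m X) = \<eta> \<cdot>\<^sub>m 1\<^sub>m m" by simp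
    then have "X = \<eta> \<cdot>\<^sub>m 1\<^sub>m m"
      by (simp add: smult_smult one_smult \<eta>')
    with \<eta> show ?thesis by blast
  qed
qed (auto intro: smult_one_in_stabilizer)

theorem theorem6p2:
  fixes m :: nat
  shows "stabilizer m (C_axis :: real tensor3) = {\<eta> \<cdot>\<^sub>m 1\<^sub>m m | \<eta> :: real. \<eta> ^ 3 = 1} \<and>
         stabilizer m (C_axis :: complex tensor3) = {\<eta> \<cdot>\<^sub>m 1\<^sub>m m | \<eta> :: complex. \<eta> ^ 3 = 1}"
  by (intro conjI stabilizer_C_axis)

end
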